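(* Let $B(x,y) := \sum_{n,m \geq 1} \frac{|\mathcal{B}_{n,m}|}{n!} x^n y^m$. Then the formal power series $B(x,y)$ satisfies $$\frac{\partial B}{\partial x}(x,y) = (y+1)e^{B(x,y)} - B(x,y) - 1, \qquad B(0,y) = 0.$$
   Context: For $n \ge m \ge 1$, $\mathcal B_{n,m}$ is the set of non-plane (unordered) labelled rooted trees on $n$ nodes such that: each node is labelled by a value in $\{0,\dots,n-1\}$, each such value labelling exactly one node; the tree is increasing (every non-root node has a greater label than its parent); each node is coloured blue or red, with exactly $m$ blue nodes and $n-m$ red nodes; and each red node has at least two children. For $n<m$, $\mathcal B_{n,m}=\emptyset$. *)

theory Defs
  imports
    "HOL-Library.Multiset"
    "HOL-Computational_Algebra.Formal_Power_Series"
begin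

datatype colour = Blue | Red

text \<open>Non-plane coloured trees: the children form a multiset, so they carry no order.\<close>

datatype tree = Node (label: nat) (col: colour) (children: "tree multiset")

text \<open>A node is represented by the subtree it is the root of; \<open>nodes t\<close> counts
  each node of \<open>t\<close> once, even if several nodes carry equal subtrees.\<close>

primrec nodes :: "tree \<Rightarrow> tree multiset" where
  "nodes (Node l c ts) = add_mset (Node l c ts) (\<Sum>\<^sub># (image_mset nodes ts))"

definition increasing :: "tree \<Rightarrow> bool" where
  "increasing t \<longleftrightarrow> (\<forall>s \<in># nodes t. \<forall>u \<in># children s. label s < label u)"

definition num_col :: "colour \<Rightarrow> tree \<Rightarrow> nat" where
  "num_col c t = size (filter_mset (\<lambda>s. col s = c) (nodes t))"

text \<open>The equation between multisets says that all labels lie in \<open>{0..<n}\<close> and that each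
  of these values labels exactly one node; in particular, \<open>t\<close> has \<open>n\<close> nodes.\<close>

definition B_trees :: "nat \<Rightarrow> nat \<Rightarrow> tree set" where
  "B_trees n m = {t. m \<le> n
      \<and> image_mset label (nodes t) = mset_set {0..<n}
      \<and> increasing t
      \<and> num_col Blue t = m \<and> num_col Red t = n - m
      \<and> (\<forall>s \<in># nodes t. col s = Red \<longrightarrow> size (children s) \<ge> 2)}"

text \<open>A bivariate series in \<open>x\<close> and \<open>y\<close> is a series in \<open>x\<close> whose coefficients are series
  in \<open>y\<close>. Thus \<open>fps_deriv\<close> is the partial derivative with respect to \<open>x\<close>, the series \<open>y\<close> is
  \<open>fps_const fps_X\<close>, and setting \<open>x = 0\<close> means taking the coefficient at \<open>0\<close>.\<close>

definition B_series :: "rat fps fps" where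
  "B_series = Abs_fps (\<lambda>n. Abs_fps (\<lambda>m.
     if n \<ge> 1 \<and> m \<ge> 1 then of_nat (card (B_trees n m)) / fact n else 0))"

abbreviation y_var :: "rat fps fps" where
  "y_var \<equiv> fps_const fps_X"

text \<open>In \<open>fps_exp 1\<close> over the coefficient ring \<open>rat fps\<close> the division is that of \<open>rat fps\<close>.
  It is a division by units, so this is the usual exponential series.\<close>

lemma fps_exp_rat_fps:
  "fps_exp (1 :: rat fps) = Abs_fps (\<lambda>k. fps_const (1 / fact k))"
proof (rule fps_ext)
  fix k :: nat
  have "(of_nat (fact k) :: rat fps) = fps_const (fact k)"
    by (simp flip: fps_of_nat)
  moreover have "(1 :: rat fps) / fps_const (fact k) = fps_const (1 / fact k)"
    by (metis fps_const_1_eq_1 fps_const_divide)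
  ultimately show "fps_nth (fps_exp (1 :: rat fps)) k =
      fps_nth (Abs_fps (\<lambda>k. fps_const (1 / fact k))) k"
    by (simp add: fps_exp_def)
qed

text \<open>Since \<open>B_series\<close> has no constant coefficient in \<open>x\<close>, the composition
  \<open>fps_compose (fps_exp 1) B_series\<close> is \<open>exp\<close> of \<open>B_series\<close>.\<close>

end

theory Submission imports Defs begin

text \<open>Removing the root of a tree leaves a forest, and removing from a forest the tree that
  contains a given label leaves a smaller forest. Counted with weight \<open>y\<close> per blue node, this
  expresses the weights on a label set through those on smaller label sets, so that they depend
  only on the number of labels. The two recursions say that \<open>B' = (y + 1) F - B - 1\<close> and
  \<open>F' = B' F\<close> for the exponential generating function \<open>F\<close> of forests; hence \<open>F = exp B\<close>.\<close>

section \<open>Trees and forests on a set of labels\<close>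

definition good :: "tree \<Rightarrow> bool" where
  "good t \<longleftrightarrow> increasing t \<and> (\<forall>s \<in># nodes t. col s = Red \<longrightarrow> size (children s) \<ge> 2)"

text \<open>Kept as a multiset so that repetitions stay visible: for finite \<open>S\<close>,
  equality with \<open>mset_set S\<close> says that each element of \<open>S\<close> labels exactly
  one node.\<close>

definition labels :: "tree \<Rightarrow> nat multiset" where
  "labels t = image_mset label (nodes t)"

definition flabels :: "tree multiset \<Rightarrow> nat multiset" where
  "flabels ts = \<Sum>\<^sub># (image_mset labels ts)"

definition fblue :: "tree multiset \<Rightarrow> nat" where
  "fblue ts = \<Sum>\<^sub># (image_mset (num_col Blue) ts)"

text \<open>Arbitrary label sets are allowed, since the pieces left after a removal need not carry
  the labels of an initial segment.\<close>

definition trees :: "nat set \<Rightarrow> tree set" where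
  "trees S = {t. good t \<and> labels t = mset_set S}"

definition forests :: "nat set \<Rightarrow> tree multiset set" where
  "forests S = {ts. (\<forall>t \<in># ts. good t) \<and> flabels ts = mset_set S}"

section \<open>Labels and colours, recursively along the children\<close>

lemma good_Node [simp]:
  "good (Node l c ts) \<longleftrightarrow>
    (\<forall>u \<in># ts. l < label u \<and> good u) \<and> (c = Red \<longrightarrow> size ts \<ge> 2)"
  by (auto simp: good_def increasing_def)

lemma image_mset_sum_mset: "image_mset f (\<Sum>\<^sub># M) = \<Sum>\<^sub># (image_mset (image_mset f) M)"
  by (induction M) auto

lemma filter_mset_sum_mset: "filter_mset P (\<Sum>\<^sub># M) = \<Sum>\<^sub># (image_mset (filter_mset P) M)"
  by (induction M) auto

lemma labels_Node [simp]: "labels (Node l c ts) = add_mset l (flabels ts)"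
  by (simp add: labels_def[abs_def] flabels_def image_mset_sum_mset multiset.map_comp comp_def)

lemma num_col_Node:
  "num_col k (Node l c ts) = (if c = k then 1 else 0) + \<Sum>\<^sub># (image_mset (num_col k) ts)"
  by (simp add: num_col_def[abs_def] filter_mset_sum_mset multiset.map_comp comp_def)

lemma fblue_simps [simp]:
  "fblue {#} = 0" "fblue (add_mset t ts) = num_col Blue t + fblue ts"
  by (simp_all add: fblue_def)

lemma flabels_simps [simp]:
  "flabels {#} = {#}" "flabels (add_mset t ts) = labels t + flabels ts"
  by (simp_all add: flabels_def)

lemma in_flabels: "x \<in># flabels ts \<longleftrightarrow> (\<exists>t \<in># ts. x \<in># labels t)"
  by (auto simp: flabels_def)

lemma label_in_labels [simp]: "label t \<in># labels t"
  by (cases t) auto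

lemma labels_nonempty [simp]: "labels t \<noteq> {#}"
  by (cases t) auto

text \<open>Labels grow along every path from the root. This identifies the root as the node with
  the least label.\<close>

lemma label_le: "good t \<Longrightarrow> x \<in># labels t \<Longrightarrow> label t \<le> x"
proof (induction t)
  case (Node l c ts)
  then show ?case by (fastforce simp: in_flabels)
qed

text \<open>Descending through children ends in a leaf, which cannot be red.\<close>

lemma good_blue_pos: "good t \<Longrightarrow> num_col Blue t > 0"
proof (induction t)
  case (Node l c ts)
  show ?case
  proof (cases c)
    case Red
    with Node.prems have "size ts \<ge> 2" by simp
    then obtain u where u: "u \<in># ts" by (cases ts) auto
    with Node have "num_col Blue u > 0" by simp
    moreover obtain us where "ts = add_mset u us" using u by (metis mset_add)
    ultimately show ?thesis by (simp add: num_col_Node)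
  qed (simp add: num_col_Node)
qed

lemma num_col_sum: "num_col Blue t + num_col Red t = size (labels t)"
proof -
  have "filter_mset (\<lambda>s. col s = Red) (nodes t) = filter_mset (\<lambda>s. col s \<noteq> Blue) (nodes t)"
    by (rule filter_mset_cong) (auto intro: colour.exhaust)
  then show ?thesis
    by (simp add: num_col_def labels_def flip: size_union multiset_partition)
qed

section \<open>Decomposition of trees and forests\<close>

text \<open>The least label must sit at the root, and what hangs below is any forest on the other
  labels, subject only to the size condition under a red root.\<close>

lemma trees_insert:
  assumes "finite S" "\<forall>s\<in>S. r < s"
  shows "trees (insert r S) =
    Node r Blue ` forests S \<union> Node r Red ` {ts \<in> forests S. size ts \<ge> 2}"
proof (intro Set.set_eqI iffI)
  have r: "r \<notin> S" using assms by auto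
  fix t
  {
    assume t: "t \<in> trees (insert r S)"
    obtain l c ts where [simp]: "t = Node l c ts" by (cases t)
    have g: "good t" and l: "labels t = add_mset r (mset_set S)"
      using t r assms by (auto simp: trees_def)
    \<comment> \<open>The root label is at most \<open>r\<close>, which occurs in \<open>t\<close>,
      while every other available label exceeds \<open>r\<close>.\<close>
    have "l \<le> r" using label_le[OF g, of r] unfolding l by simp
    moreover have "l \<in> insert r S" using label_in_labels[of t] assms unfolding l by simp
    ultimately have "l = r" using assms by auto
    with g l have "ts \<in> forests S" by (auto simp: forests_def)
    with \<open>l = r\<close> g show "t \<in> Node r Blue ` forests S \<union> Node r Red ` {ts \<in> forests S. size ts \<ge> 2}"
      by (cases c) auto
  next
    assume "t \<in> Node r Blue ` forests S \<union> Node r Red ` {ts \<in> forests S. size ts \<ge> 2}"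
    then obtain c ts where t: "t = Node r c ts" "ts \<in> forests S" "c = Red \<longrightarrow> size ts \<ge> 2"
      by auto
    have "r < label u" if "u \<in># ts" for u
    proof -
      have "label u \<in># flabels ts" using that label_in_labels in_flabels by blast
      then show ?thesis using t assms by (auto simp: forests_def)
    qed
    with t r assms show "t \<in> trees (insert r S)"
      by (auto simp: trees_def forests_def)
  }
qed

lemma trees_empty [simp]: "trees {} = {}"
  by (auto simp: trees_def)

lemma forests_empty [simp]: "forests {} = {{#}}"
proof -
  have "ts = {#}" if "flabels ts = {#}" for ts
    using that by (cases ts) auto
  then show ?thesis by (auto simp: forests_def)
qed

text \<open>A red root excludes this case and the next one: the empty forest accounts for the term
  -1 of the equation, the forests of one tree for -B.\<close>

lemma forests_size_0: "finite S \<Longrightarrow> {ts \<in> forests S. size ts = 0} = (if S = {} then {{#}} else {})"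
  by (auto simp: forests_def mset_set_empty_iff)

lemma forests_size_1: "{ts \<in> forests S. size ts = 1} = (\<lambda>t. {#t#}) ` trees S"
  by (auto simp: forests_def trees_def image_iff dest!: size_1_singleton_mset[unfolded One_nat_def])

text \<open>Labels are distinct, so exactly one tree of the forest contains the marked label
  \<open>r\<close>; \<open>A\<close> is the set of its other labels.\<close>

lemma forests_insert:
  assumes "finite S" "r \<notin> S"
  shows "bij_betw (\<lambda>(A, t, ts). add_mset t ts)
    (SIGMA A : Pow S. trees (insert r A) \<times> forests (S - A)) (forests (insert r S))"
proof (rule bij_betw_imageI)
  have fin: "finite A" if "A \<subseteq> S" for A using that assms finite_subset by blast
  show "inj_on (\<lambda>(A, t, ts). add_mset t ts) (SIGMA A : Pow S. trees (insert r A) \<times> forests (S - A))"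
  proof (rule inj_onI, clarify)
    fix A t ts A' t' ts'
    assume A: "A \<subseteq> S" "A' \<subseteq> S"
      and t: "t \<in> trees (insert r A)" "t' \<in> trees (insert r A')"
      and ts: "ts \<in> forests (S - A)" "ts' \<in> forests (S - A')"
      and eq: "add_mset t ts = add_mset t' ts'"
    have "r \<in># labels t" using t fin A by (auto simp: trees_def)
    moreover have "r \<notin># flabels ts'" using ts assms by (auto simp: forests_def)
    \<comment> \<open>The label \<open>r\<close> occurs in \<open>t\<close> but nowhere in
      \<open>ts'\<close>, so \<open>t\<close> can only be the tree \<open>t'\<close> singled out on
      the other side.\<close>
    ultimately have "t \<notin># ts'" by (auto simp: in_flabels)
    then have tt: "t = t'" using eq by (metis insert_noteq_member)
    then have "mset_set (insert r A) = mset_set (insert r A')"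
      using t by (simp add: trees_def)
    then have "insert r A = insert r A'" using A fin by (metis finite_insert finite_set_mset_mset_set)
    then show "A = A' \<and> (t, ts) = (t', ts')" using tt eq A assms by auto
  qed
  show "(\<lambda>(A, t, ts). add_mset t ts) ` (SIGMA A : Pow S. trees (insert r A) \<times> forests (S - A)) =
    forests (insert r S)"
  proof (intro equalityI subsetI)
    fix us
    assume "us \<in> (\<lambda>(A, t, ts). add_mset t ts) ` (SIGMA A : Pow S. trees (insert r A) \<times> forests (S - A))"
    then obtain A t ts where *: "us = add_mset t ts" "A \<subseteq> S" "t \<in> trees (insert r A)"
      "ts \<in> forests (S - A)" by auto
    have "insert r S = insert r A \<union> (S - A)" "insert r A \<inter> (S - A) = {}"
      using * assms by auto
    then have "mset_set (insert r S) = mset_set (insert r A) + mset_set (S - A)"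
      using fin[OF *(2)] assms by (metis finite_Diff finite_insert mset_set_Union)
    with * show "us \<in> forests (insert r S)" by (auto simp: forests_def trees_def)
  next
    fix us assume us: "us \<in> forests (insert r S)"
    then have "r \<in># flabels us" using assms by (simp add: forests_def)
    then obtain t where t: "t \<in># us" "r \<in># labels t" by (auto simp: in_flabels)
    obtain ts where ts: "us = add_mset t ts" using t by (metis mset_add)
    have sum: "labels t + flabels ts = mset_set (insert r S)"
      using us ts by (simp add: forests_def)
    define A where "A = set_mset (labels t) - {r}"
    have iA: "insert r A = set_mset (labels t)" using t by (auto simp: A_def)
    have "set_mset (labels t) \<subseteq> insert r S"
      using sum assms by (metis finite_insert finite_set_mset_mset_set set_mset_union sup_ge1)
    then have AS: "A \<subseteq> S" by (auto simp: A_def)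
    \<comment> \<open>Each label occurs at most once in the whole forest, hence at most once in
      \<open>t\<close>, so the multiset is determined by its support.\<close>
    have "labels t = mset_set (insert r A)"
    proof (rule multiset_eqI)
      fix x
      have "count (labels t) x + count (flabels ts) x = count (mset_set (insert r S)) x"
        by (simp flip: sum)
      also have "\<dots> \<le> 1" by (simp add: count_mset_set')
      finally have "count (labels t) x \<le> 1" by simp
      moreover have "count (labels t) x > 0 \<longleftrightarrow> x \<in> insert r A"
        by (simp add: iA)
      ultimately show "count (labels t) x = count (mset_set (insert r A)) x"
        using fin[OF AS] by (auto simp: count_mset_set' simp del: count_greater_zero_iff)
    qed
    moreover from this have "flabels ts = mset_set (insert r S) - mset_set (insert r A)"
      by (simp flip: sum)
    then have "flabels ts = mset_set (S - A)"
      using AS assms fin[OF AS]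
      by (subst (asm) mset_set_Diff[symmetric]) (auto simp: insert_Diff_if)
    ultimately have "(A, t, ts) \<in> (SIGMA A : Pow S. trees (insert r A) \<times> forests (S - A))"
      using us ts AS by (auto simp: forests_def trees_def)
    then show "us \<in> (\<lambda>(A, t, ts). add_mset t ts) `
      (SIGMA A : Pow S. trees (insert r A) \<times> forests (S - A))"
      using ts by (intro image_eqI[of _ _ "(A, t, ts)"]) simp_all
  qed
qed

section \<open>Induction on the number of labels; finiteness\<close>

text \<open>Splits off the minimum, because \<open>trees_insert\<close> needs the new label below
  all others.\<close>

lemma min_insert_cases:
  fixes S :: "nat set"
  assumes "finite S" "card S = Suc n"
  obtains r S0 where "S = insert r S0" "finite S0" "\<forall>s\<in>S0. r < s" "r \<notin> S0" "card S0 = n"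
proof
  have "S \<noteq> {}" using assms by auto
  then show "S = insert (Min S) (S - {Min S})" using assms(1) by (auto simp: insert_absorb)
  show "card (S - {Min S}) = n" using assms \<open>S \<noteq> {}\<close> by simp
qed (use assms in \<open>auto simp: less_le\<close>)

lemma finite_trees_forests:
  assumes "finite S"
  shows "finite (trees S)" "finite (forests S)"
proof -
  have "\<forall>S. finite S \<and> card S = n \<longrightarrow> finite (trees S) \<and> finite (forests S)" for n
  proof (induction n rule: less_induct)
    case (less n)
    show ?case
    proof (intro allI impI)
      fix S :: "nat set" assume S: "finite S \<and> card S = n"
      show "finite (trees S) \<and> finite (forests S)"
      proof (cases n)
        case 0
        with S show ?thesis by auto
      next
        case (Suc k)
        with S obtain r S0 where S0: "S = insert r S0" "finite S0" "\<forall>s\<in>S0. r < s" "r \<notin> S0"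
          "card S0 = k" by (metis min_insert_cases)
        have "finite (forests S0)" using less Suc S0 by blast
        \<comment> \<open>Trees are settled before forests: for \<open>A = S0\<close>, the forest
          decomposition involves the trees on all of \<open>S\<close>, which the induction
          hypothesis does not reach.\<close>
        then have T: "finite (trees S)" using S0 by (simp add: trees_insert)
        have "finite (trees (insert r A) \<times> forests (S0 - A))" if A: "A \<in> Pow S0" for A
        proof (rule finite_cartesian_product)
          have fA: "finite A" using A S0 finite_subset by auto
          have "card (S0 - A) < n" using card_mono[of S0 "S0 - A"] S0 Suc by auto
          then show "finite (forests (S0 - A))" using less S0 by blast
          show "finite (trees (insert r A))"
          proof (cases "A = S0")
            case False
            then have "card A < k" using A S0 psubset_card_mono[of S0 A] by auto
            then have "card (insert r A) < n" using Suc fA by (simp add: card_insert_if)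
            then show ?thesis using less fA by blast
          qed (use T S0 in simp)
        qed
        moreover have "finite (Pow S0)" using S0(2) by simp
        ultimately have "finite (SIGMA A : Pow S0. trees (insert r A) \<times> forests (S0 - A))"
          by (rule finite_SigmaI[rotated])
        then have "finite (forests S)"
          using bij_betw_finite[OF forests_insert[OF S0(2,4)]] S0(1) by simp
        with T show ?thesis by simp
      qed
    qed
  qed
  with assms show "finite (trees S)" "finite (forests S)" by blast+
qed

section \<open>Weights\<close>

text \<open>Here \<open>fps_X\<close> is the variable y of the coefficient ring. For finite
  \<open>S\<close> the coefficient of y^m counts the trees with m blue nodes.\<close>

definition tree_weight :: "nat set \<Rightarrow> rat fps" where
  "tree_weight S = (\<Sum>t\<in>trees S. fps_X ^ num_col Blue t)"

definition forest_weight :: "nat set \<Rightarrow> rat fps" where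
  "forest_weight S = (\<Sum>ts\<in>forests S. fps_X ^ fblue ts)"

lemma tree_weight_empty [simp]: "tree_weight {} = 0"
  by (simp add: tree_weight_def)

lemma forest_weight_empty [simp]: "forest_weight {} = 1"
  by (simp add: forest_weight_def)

text \<open>A blue root contributes a factor y over all forests; a red root contributes all forests
  except those with one tree or none.\<close>

lemma tree_weight_insert:
  assumes "finite S" "\<forall>s\<in>S. r < s"
  shows "tree_weight (insert r S) =
    (fps_X + 1) * forest_weight S - tree_weight S - (if S = {} then 1 else 0)"
proof -
  let ?w = "\<lambda>ts. fps_X ^ fblue ts :: rat fps"
  note fin = finite_trees_forests[OF assms(1)]
  have split: "forests S = {ts \<in> forests S. size ts \<ge> 2} \<union>
      ({ts \<in> forests S. size ts = 1} \<union> {ts \<in> forests S. size ts = 0})"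
    by (auto simp: not_le less_Suc_eq numeral_2_eq_2)
  have "forest_weight S = sum ?w {ts \<in> forests S. size ts \<ge> 2} +
      (sum ?w {ts \<in> forests S. size ts = 1} + sum ?w {ts \<in> forests S. size ts = 0})"
    unfolding forest_weight_def by (subst split, (subst sum.union_disjoint; use fin in auto)+)
  also have "sum ?w {ts \<in> forests S. size ts = 1} = tree_weight S"
    unfolding forests_size_1 tree_weight_def by (simp add: sum.reindex inj_on_def)
  also have "sum ?w {ts \<in> forests S. size ts = 0} = (if S = {} then 1 else 0)"
    unfolding forests_size_0[OF assms(1)] by simp
  finally have forest: "sum ?w {ts \<in> forests S. size ts \<ge> 2} =
      forest_weight S - tree_weight S - (if S = {} then 1 else 0)"
    by (simp add: algebra_simps)
  have "tree_weight (insert r S) = fps_X * forest_weight S + sum ?w {ts \<in> forests S. size ts \<ge> 2}"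
    unfolding tree_weight_def trees_insert[OF assms] forest_weight_def
    by (subst sum.union_disjoint)
      (use fin in \<open>auto simp: sum.reindex inj_on_def num_col_Node fblue_def sum_distrib_left\<close>)
  with forest show ?thesis by (simp add: algebra_simps)
qed

text \<open>The numbers of blue nodes add up under \<open>forests_insert\<close>, so the weights
  multiply.\<close>

lemma forest_weight_insert:
  assumes "finite S" "r \<notin> S"
  shows "forest_weight (insert r S) =
    (\<Sum>A\<in>Pow S. tree_weight (insert r A) * forest_weight (S - A))"
proof -
  have fin: "finite A" if "A \<subseteq> S" for A using that assms finite_subset by blast
  have "forest_weight (insert r S) =
    (\<Sum>(A, t, ts)\<in>(SIGMA A : Pow S. trees (insert r A) \<times> forests (S - A)).
      fps_X ^ num_col Blue t * fps_X ^ fblue ts)"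
    unfolding forest_weight_def
    by (subst sum.reindex_bij_betw[OF forests_insert[OF assms], symmetric])
      (auto intro!: sum.cong simp: power_add)
  also have "\<dots> = (\<Sum>A\<in>Pow S. \<Sum>(t, ts)\<in>trees (insert r A) \<times> forests (S - A).
      fps_X ^ num_col Blue t * fps_X ^ fblue ts)"
    by (subst sum.Sigma[symmetric])
      (use assms fin in \<open>auto intro!: finite_cartesian_product finite_trees_forests\<close>)
  finally show ?thesis
    by (simp add: tree_weight_def forest_weight_def sum_product sum.cartesian_product)
qed

section \<open>Weights depend only on the number of labels\<close>

text \<open>Grouping subsets by size turns a sum over label sets into a binomial sum, the shape of a
  product of exponential generating functions.\<close>

lemma sum_Pow_card:
  fixes g :: "nat \<Rightarrow> 'a :: semiring_1"
  assumes "finite S"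
  shows "(\<Sum>A\<in>Pow S. g (card A)) = (\<Sum>k\<le>card S. of_nat (card S choose k) * g k)"
proof -
  have "(\<Sum>A\<in>Pow S. g (card A)) = (\<Sum>k\<le>card S. \<Sum>A\<in>{A \<in> Pow S. card A = k}. g (card A))"
    using assms by (intro sum.group[symmetric]) (auto intro: card_mono)
  also have "\<dots> = (\<Sum>k\<le>card S. of_nat (card {A. A \<subseteq> S \<and> card A = k}) * g k)"
    by (intro sum.cong) auto
  finally show ?thesis using assms by (simp add: n_subsets)
qed

abbreviation tw :: "nat \<Rightarrow> rat fps" where "tw n \<equiv> tree_weight {0..<n}"
abbreviation fw :: "nat \<Rightarrow> rat fps" where "fw n \<equiv> forest_weight {0..<n}"

text \<open>Dependence on cardinality alone is assumed here only for the sets that occur, so that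
  the recursion is available inside the induction that proves this dependence.\<close>

lemma forest_weight_rec:
  assumes "finite S" "r \<notin> S"
    and "\<And>A. A \<subseteq> S \<Longrightarrow> tree_weight (insert r A) = tw (Suc (card A))"
    and "\<And>A. A \<subseteq> S \<Longrightarrow> forest_weight A = fw (card A)"
  shows "forest_weight (insert r S) =
    (\<Sum>k\<le>card S. of_nat (card S choose k) * (tw (Suc k) * fw (card S - k)))"
proof -
  have "forest_weight (insert r S) =
      (\<Sum>A\<in>Pow S. tw (Suc (card A)) * fw (card S - card A))"
    unfolding forest_weight_insert[OF assms(1,2)]
    using assms by (intro sum.cong refl) (simp add: card_Diff_subset finite_subset)
  then show ?thesis by (simp add: sum_Pow_card[OF assms(1), of "\<lambda>k. tw (Suc k) * fw (card S - k)"])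
qed

text \<open>Strong induction on the number of labels: both recursions express the weights through
  weights that are already known to depend on cardinality alone.\<close>

lemma weights_card:
  assumes "finite S"
  shows "tree_weight S = tw (card S)" "forest_weight S = fw (card S)"
proof -
  have "\<forall>S S' :: nat set. finite S \<and> finite S' \<and> card S = n \<and> card S' = n \<longrightarrow>
      tree_weight S = tree_weight S' \<and> forest_weight S = forest_weight S'" for n
  proof (induction n rule: less_induct)
    case (less n)
    have lessD: "tree_weight A = tw (card A)" "forest_weight A = fw (card A)"
      if "card A < n" "finite A" for A
      using less[OF that(1)] that(2) by (metis card_atLeastLessThan diff_zero finite_atLeastLessThan)+
    show ?case
    proof (cases n)
      case 0
      then show ?thesis by auto
    next
      case (Suc k)
      have tree: "tree_weight S = (fps_X + 1) * fw k - tw k - (if k = 0 then 1 else 0)"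
        if S: "finite S" "card S = n" for S
      proof -
        obtain r S0 where S0: "S = insert r S0" "finite S0" "\<forall>s\<in>S0. r < s" "card S0 = k"
          using S Suc by (metis min_insert_cases)
        then have "tree_weight S0 = tw k" "forest_weight S0 = fw k" "S0 = {} \<longleftrightarrow> k = 0"
          using lessD[of S0] Suc by auto
        then show ?thesis unfolding S0(1) tree_weight_insert[OF S0(2,3)] by simp
      qed
      have forest: "forest_weight S = (\<Sum>i\<le>k. of_nat (k choose i) * (tw (Suc i) * fw (k - i)))"
        if S: "finite S" "card S = n" for S
      proof -
        obtain r S0 where S0: "S = insert r S0" "finite S0" "r \<notin> S0" "card S0 = k"
          using S Suc by (metis min_insert_cases)
        have fA: "finite A" "card A \<le> k" if "A \<subseteq> S0" for A
          using that S0 card_mono finite_subset by blast+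
        have "tree_weight (insert r A) = tw (Suc (card A))" if "A \<subseteq> S0" for A
        proof -
          have "card (insert r A) = Suc (card A)" using that S0 fA by (subst card_insert_disjoint) auto
          \<comment> \<open>In this extreme case \<open>insert r A\<close> has all n labels, so the
            fact \<open>tree\<close> replaces the induction hypothesis.\<close>
          moreover have "tree_weight (insert r A) = tw (Suc (card A))" if "card A = k"
            using tree[of "insert r A"] tree[of "{0..<n}"] calculation that Suc fA[OF \<open>A \<subseteq> S0\<close>] by simp
          ultimately show ?thesis using lessD[of "insert r A"] fA[OF that] Suc
            by (cases "card A = k") auto
        qed
        moreover have "forest_weight A = fw (card A)" if "A \<subseteq> S0" for A
          using lessD(2)[of A] fA[OF that] Suc by linarith
        ultimately have "forest_weight (insert r S0) =
            (\<Sum>i\<le>card S0. of_nat (card S0 choose i) * (tw (Suc i) * fw (card S0 - i)))"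
          by (rule forest_weight_rec[OF S0(2,3)])
        then show ?thesis by (simp only: S0)
      qed
      show ?thesis using tree forest by metis
    qed
  qed
  from this[of "card S"] assms show "tree_weight S = tw (card S)" "forest_weight S = fw (card S)"
    by (metis card_atLeastLessThan diff_zero finite_atLeastLessThan)+
qed

lemma tw_Suc: "tw (Suc n) = (fps_X + 1) * fw n - tw n - (if n = 0 then 1 else 0)"
proof -
  \<comment> \<open>The root takes the least label 0; \<open>weights_card\<close> then shifts the
    remaining labels back to an initial segment.\<close>
  have "{0..<Suc n} = insert 0 {1..<Suc n}" by auto
  then have "tw (Suc n) = (fps_X + 1) * forest_weight {1..<Suc n} - tree_weight {1..<Suc n} -
      (if n = 0 then 1 else 0)"
    by (simp add: tree_weight_insert)
  then show ?thesis using weights_card[of "{1..<Suc n}"] by simp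
qed

lemma fw_Suc: "fw (Suc n) = (\<Sum>k\<le>n. of_nat (n choose k) * (tw (Suc k) * fw (n - k)))"
proof -
  have "tree_weight (insert n A) = tw (Suc (card A))" if "A \<subseteq> {0..<n}" for A
  proof -
    have "finite A" "n \<notin> A" using that finite_subset by auto
    then show ?thesis using weights_card(1)[of "insert n A"] by simp
  qed
  moreover have "forest_weight A = fw (card A)" if "A \<subseteq> {0..<n}" for A
    using that weights_card(2)[of A] finite_subset by blast
  \<comment> \<open>The marked label is the largest one, n, so that the remaining labels are already
    \<open>{0..<n}\<close>.\<close>
  ultimately have "forest_weight (insert n {0..<n}) =
      (\<Sum>k\<le>card {0..<n}. of_nat (card {0..<n} choose k) *
        (tw (Suc k) * fw (card {0..<n} - k)))"
    by (intro forest_weight_rec) auto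
  then show ?thesis by (simp add: atLeast0_lessThan_Suc)
qed

section \<open>Generating functions\<close>

text \<open>The exponential generating function in x; the coefficients are scaled by a constant
  series, which avoids division in \<open>rat fps\<close>.\<close>

definition egf :: "(nat \<Rightarrow> rat fps) \<Rightarrow> rat fps fps" where
  "egf a = Abs_fps (\<lambda>n. fps_const (1 / fact n) * a n)"

lemma egf_nth [simp]: "fps_nth (egf a) n = fps_const (1 / fact n) * a n"
  by (simp add: egf_def)

lemma of_nat_Suc_div_fact:
  "of_nat (Suc n) * fps_const (1 / fact (Suc n)) = fps_const (1 / fact n :: rat)"
  by (simp add: fps_of_nat[symmetric] divide_simps del: of_nat_Suc)

lemma fps_deriv_egf: "fps_deriv (egf a) = egf (\<lambda>n. a (Suc n))"
proof (rule fps_ext)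
  fix n
  show "fps_nth (fps_deriv (egf a)) n = fps_nth (egf (\<lambda>n. a (Suc n))) n"
    using of_nat_Suc_div_fact[of n] by (simp add: mult.assoc[symmetric] del: of_nat_Suc fact_Suc)
qed

text \<open>Rests on 1/k! * 1/(n-k)! = (n choose k)/n!. The right-hand side has the form of
  \<open>fw_Suc\<close>.\<close>

lemma egf_mult:
  "egf a * egf b = egf (\<lambda>n. \<Sum>k\<le>n. of_nat (n choose k) * (a k * b (n - k)))"
proof (rule fps_ext)
  fix n
  have "fps_const (1 / fact k) * a k * (fps_const (1 / fact (n - k)) * b (n - k)) =
      fps_const (1 / fact n) * (of_nat (n choose k) * (a k * b (n - k)))" if "k \<le> n" for k
  proof -
    have "fps_const (1 / fact k) * fps_const (1 / fact (n - k)) =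
        (fps_const (1 / fact n) * of_nat (n choose k) :: rat fps)"
      using that by (simp add: fps_of_nat[symmetric] binomial_fact field_simps)
    then show ?thesis by (metis (no_types, lifting) mult.assoc mult.left_commute)
  qed
  then show "fps_nth (egf a * egf b) n =
      fps_nth (egf (\<lambda>n. \<Sum>k\<le>n. of_nat (n choose k) * (a k * b (n - k)))) n"
    unfolding fps_mult_nth egf_nth sum_distrib_left atLeast0AtMost by (intro sum.cong) auto
qed

lemma fps_exp_egf: "fps_exp 1 = egf (\<lambda>_. 1)"
  by (simp add: fps_exp_rat_fps egf_def)

text \<open>Coefficient k of \<open>H * F\<close> uses only the coefficients of \<open>F\<close> up
  to k, and it equals k+1 times coefficient k+1 of \<open>F\<close>; in characteristic 0 that factor
  cancels.\<close>

lemma linear_ode_unique: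
  fixes F G H :: "'a :: {idom, semiring_char_0} fps"
  assumes "fps_deriv F = H * F" "fps_deriv G = H * G" "fps_nth F 0 = fps_nth G 0"
  shows "F = G"
proof (rule fps_ext)
  fix n
  show "fps_nth F n = fps_nth G n"
  proof (induction n rule: less_induct)
    case (less n)
    show ?case
    proof (cases n)
      case (Suc k)
      have "fps_nth (fps_deriv F) k = fps_nth (fps_deriv G) k"
        unfolding assms fps_mult_nth using less Suc by (intro sum.cong) auto
      with Suc show ?thesis by (simp del: of_nat_Suc)
    qed (use assms in simp)
  qed
qed

section \<open>The series of the trees and its differential equation\<close>

lemma B_series_egf: "B_series = egf tw"
proof (intro fps_ext)
  fix n m
  have eq: "B_trees n m = {t \<in> trees {0..<n}. num_col Blue t = m}"
  proof (intro Set.set_eqI)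
    fix t
    \<comment> \<open>With n nodes in total, having m blue nodes amounts to m \<le> n together with
      n - m red nodes.\<close>
    have "num_col Blue t + num_col Red t = n" if "labels t = mset_set {0..<n}"
      using that num_col_sum[of t] by simp
    then show "t \<in> B_trees n m \<longleftrightarrow> t \<in> {t \<in> trees {0..<n}. num_col Blue t = m}"
      by (auto simp: B_trees_def trees_def good_def labels_def)
  qed
  have "fps_nth (tw n) m = (\<Sum>t\<in>trees {0..<n}. if num_col Blue t = m then 1 else 0)"
    unfolding tree_weight_def fps_sum_nth by (intro sum.cong) (auto simp: fps_X_power_nth)
  also have "\<dots> = of_nat (card (B_trees n m))"
    using finite_trees_forests[of "{0..<n}"] by (simp add: eq sum.If_cases Int_def)
  finally have "fps_nth (tw n) m = of_nat (card (B_trees n m))" .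
  \<comment> \<open>\<open>B_series\<close> has coefficient 0 at these indices by definition, and
    this agrees with the count: a tree has a node, and a good tree has a blue one.\<close>
  moreover have "B_trees n m = {}" if "n = 0 \<or> m = 0"
    using that good_blue_pos by (auto simp: eq trees_def) (metis less_irrefl)
  ultimately show "fps_nth (fps_nth B_series n) m = fps_nth (fps_nth (egf tw) n) m"
    by (auto simp: B_series_def)
qed

text \<open>Both sides solve F' = B' F with constant coefficient 1: the left by the chain rule, the
  right by \<open>fw_Suc\<close>.\<close>

lemma exp_B_series: "fps_compose (fps_exp 1) B_series = egf fw"
proof (rule linear_ode_unique)
  have B0: "fps_nth B_series 0 = 0" by (simp add: B_series_egf)
  have "fps_deriv (fps_exp (1 :: rat fps)) = fps_exp 1"
    by (simp add: fps_exp_egf fps_deriv_egf)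
  then show "fps_deriv (fps_compose (fps_exp 1) B_series) =
      fps_deriv B_series * fps_compose (fps_exp 1) B_series"
    by (simp add: fps_compose_deriv[OF B0] mult.commute)
  show "fps_deriv (egf fw) = fps_deriv B_series * egf fw"
    by (simp add: B_series_egf fps_deriv_egf egf_mult fw_Suc)
  show "fps_nth (fps_compose (fps_exp 1) B_series) 0 = fps_nth (egf fw) 0"
    by (simp add: fps_exp_egf)
qed

theorem theorem5p2:
  "fps_deriv B_series = (y_var + 1) * fps_compose (fps_exp 1) B_series - B_series - 1
   \<and> fps_nth B_series 0 = 0"
proof
  show "fps_nth B_series 0 = 0" by (simp add: B_series_egf)
  show "fps_deriv B_series = (y_var + 1) * fps_compose (fps_exp 1) B_series - B_series - 1"
  proof (rule fps_ext)
    fix n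
    \<comment> \<open>The factor y + 1 is constant in x and acts coefficientwise, so the equation at
      x^n is \<open>tw_Suc\<close> divided by n!; the extra term of \<open>tw_Suc\<close> at n = 0
      is the coefficient of the series 1.\<close>
    have "fps_nth ((y_var + 1) * egf fw) n = (fps_X + 1) * fps_nth (egf fw) n"
      by (simp add: distrib_right)
    then show "fps_nth (fps_deriv B_series) n =
        fps_nth ((y_var + 1) * fps_compose (fps_exp 1) B_series - B_series - 1) n"
      unfolding exp_B_series
      by (simp add: B_series_egf fps_deriv_egf tw_Suc algebra_simps del: fps_const_mult_left)
  qed
qed

end
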